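(* Let $\lambda\in\{1,-1\}$ and let $u$ be a smooth solution of $iu_t+\Delta u-\lambda|u|^2u=0$ on $\overline{\mathcal{D}}\times[0,T]$. For $\tau>0$, $t_n=n\tau$, put $$ \widetilde R(t_{n}):=\frac1{12}\bigl(-u(t_{n})+7u(t_{n-1})+7u(t_{n-2})-u(t_{n-3})\bigr), $$ and for $n\ge3$ with $t_{n+1}\le T$ define the local truncation error of the four-step symmetric scheme by $$ TE^n:=\frac{i}{\tau}\bigl(\widetilde R(t_{n+1})-\widetilde R(t_n)\bigr)+\frac12\Delta\bigl(\widetilde R(t_{n+1})+\widetilde R(t_n)\bigr)-\frac{\lambda}{4}\bigl(|\widetilde R(t_{n+1})|^2+|\widetilde R(t_n)|^2\bigr)\bigl(\widetilde R(t_{n+1})+\widetilde R(t_n)\bigr). $$ Then $TE^n=O(\tau^2)$; that is, there is a constant $C$, independent of $\tau$ and $n$, such that $\sup_{x\in\mathcal{D}}|TE^n(x)|\le C\tau^2$ for all such $\tau$ and $n$.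
   Context: $\mathcal{D}\subset\mathbf{R}^d$ ($d=1,2,3$) is a bounded domain, $T>0$, $i=\sqrt{-1}$, and $u:\overline{\mathcal{D}}\times[0,T]\to\mathbf{C}$ is of class $C^\infty$ up to the boundary; $u(t)$ denotes the function $x\mapsto u(x,t)$. The four-step symmetric scheme is $$\frac{i}{\tau}(R^{n+1}-R^n)=-\Delta R^{n+1/2}+\frac{\lambda}{2}\bigl(|R^{n}|^2+|R^{n+1}|^2\bigr)R^{n+1/2},\qquad R^{n+1/2}=\tfrac12(R^{n+1}+R^n),$$ with $R^{n+1}=\frac{1}{12}(-u^{n+1}+7u^n+7u^{n-1}-u^{n-2})$. *)

theory Defs
  imports "HOL-Analysis.Analysis"
begin

definition partial_deriv :: "'a::real_normed_vector \<Rightarrow> ('a \<Rightarrow> 'b::real_normed_vector) \<Rightarrow> 'a \<Rightarrow> 'b" where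
  "partial_deriv b f p = vector_derivative (\<lambda>s. f (p + s *\<^sub>R b)) (at 0)"

definition laplacian :: "('a::euclidean_space \<Rightarrow> 'b::real_normed_vector) \<Rightarrow> 'a \<Rightarrow> 'b" where
  "laplacian f x = (\<Sum>b\<in>Basis. partial_deriv b (partial_deriv b f) x)"

text \<open>
  Derivatives up to the boundary of an open set \<open>U\<close>: off \<open>U\<close> the value is the limit from
  inside \<open>U\<close>. Only the values on the closure of \<open>U\<close> are meaningful. No regularity of the
  boundary is needed, and one-sided difference quotients at boundary points (which may make no
  sense there) are avoided.
\<close>

definition partial_deriv_cl ::
    "'a::real_normed_vector set \<Rightarrow> 'a \<Rightarrow> ('a \<Rightarrow> 'b::real_normed_vector) \<Rightarrow> 'a \<Rightarrow> 'b" where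
  "partial_deriv_cl U b f p =
     (if p \<in> U then partial_deriv b f p else Lim (at p within U) (partial_deriv b f))"

primrec partial_derivs_cl ::
    "'a::real_normed_vector set \<Rightarrow> 'a list \<Rightarrow> ('a \<Rightarrow> 'b::real_normed_vector) \<Rightarrow> 'a \<Rightarrow> 'b" where
  "partial_derivs_cl U [] f = f"
| "partial_derivs_cl U (b # bs) f = partial_deriv_cl U b (partial_derivs_cl U bs f)"

text \<open>
  The class \<open>C\<^sup>\<infinity>\<close> up to the boundary: \<open>f\<close> has partial derivatives of all orders (in any order
  of differentiation) in the open set \<open>U\<close>, and \<open>f\<close> and each of these derivatives is continuous
  up to the boundary. If some derivative had no continuous extension, the boundary values chosen
  above could not make it continuous on the closure.
\<close>

definition smooth_up_to_boundary ::
    "'a::euclidean_space set \<Rightarrow> ('a \<Rightarrow> 'b::real_normed_vector) \<Rightarrow> bool" where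
  "smooth_up_to_boundary U f \<longleftrightarrow>
     (\<forall>bs\<in>lists Basis.
        continuous_on (closure U) (partial_derivs_cl U bs f) \<and>
        (\<forall>p\<in>U. \<forall>b\<in>Basis. (\<lambda>s. partial_derivs_cl U bs f (p + s *\<^sub>R b)) differentiable (at 0)))"

text \<open>
  For functions of \<open>(x, t)\<close>, the basis directions are \<open>(b, 0)\<close> with \<open>b\<close> a spatial basis vector,
  and \<open>(0, 1)\<close>. The space-time cylinder is taken open; its closure is
  \<open>closure D \<times> {0..T}\<close> when \<open>T > 0\<close>.
\<close>

abbreviation cylinder :: "'a::euclidean_space set \<Rightarrow> real \<Rightarrow> ('a \<times> real) set" where
  "cylinder D T \<equiv> D \<times> {0<..<T}"

definition time_deriv_cl ::
    "('a::euclidean_space \<times> real) set \<Rightarrow> ('a \<times> real \<Rightarrow> complex) \<Rightarrow> 'a \<times> real \<Rightarrow> complex" where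
  "time_deriv_cl U u = partial_deriv_cl U (0, 1) u"

definition space_laplacian_cl ::
    "('a::euclidean_space \<times> real) set \<Rightarrow> ('a \<times> real \<Rightarrow> complex) \<Rightarrow> 'a \<times> real \<Rightarrow> complex" where
  "space_laplacian_cl U u p =
     (\<Sum>b\<in>Basis. partial_deriv_cl U (b, 0) (partial_deriv_cl U (b, 0) u) p)"

definition smooth_NLS_solution ::
    "real \<Rightarrow> 'a::euclidean_space set \<Rightarrow> real \<Rightarrow> ('a \<times> real \<Rightarrow> complex) \<Rightarrow> bool" where
  "smooth_NLS_solution lam D T u \<longleftrightarrow>
     smooth_up_to_boundary (cylinder D T) u \<and>
     (\<forall>x\<in>closure D. \<forall>t\<in>{0..T}.
        \<i> * time_deriv_cl (cylinder D T) u (x, t) + space_laplacian_cl (cylinder D T) u (x, t)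
          - of_real (lam * (cmod (u (x, t)))\<^sup>2) * u (x, t) = 0)"

definition R_tilde :: "('a \<times> real \<Rightarrow> complex) \<Rightarrow> real \<Rightarrow> nat \<Rightarrow> 'a \<Rightarrow> complex" where
  "R_tilde u \<tau> n x =
     (1/12) * (- u (x, real n * \<tau>) + 7 * u (x, (real n - 1) * \<tau>)
               + 7 * u (x, (real n - 2) * \<tau>) - u (x, (real n - 3) * \<tau>))"

text \<open>
  The Laplacian below is the ordinary one of a time slice at an interior point \<open>x\<close>. For \<open>u\<close>
  smooth up to the boundary it exists for every time in \<open>{0..T}\<close>, including the end points.
\<close>

definition trunc_error ::
    "real \<Rightarrow> ('a::euclidean_space \<times> real \<Rightarrow> complex) \<Rightarrow> real \<Rightarrow> nat \<Rightarrow> 'a \<Rightarrow> complex" where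
  "trunc_error lam u \<tau> n x =
     (\<i> / of_real \<tau>) * (R_tilde u \<tau> (n + 1) x - R_tilde u \<tau> n x)
     + (1/2) * laplacian (\<lambda>y. R_tilde u \<tau> (n + 1) y + R_tilde u \<tau> n y) x
     - of_real (lam / 4 * ((cmod (R_tilde u \<tau> (n + 1) x))\<^sup>2 + (cmod (R_tilde u \<tau> n x))\<^sup>2))
       * (R_tilde u \<tau> (n + 1) x + R_tilde u \<tau> n x)"

end

theory Submission
  imports Defs
begin

text \<open>
  The scheme is symmetric about \<open>c = t\<^bsub>n-1\<^esub>\<close>: writing \<open>R' = R(t\<^bsub>n+1\<^esub>)\<close> and \<open>R = R(t\<^sub>n)\<close>, both the mean
  \<open>m = (R' + R)/2\<close> and the increment \<open>d = R' - R\<close> are combinations of the five values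
  \<open>u(c + k\<tau>)\<close>, \<open>-2 \<le> k \<le> 2\<close>, with even weights of sum \<open>1\<close> for \<open>m\<close> and odd weights of first moment
  \<open>1\<close> for \<open>d\<close> (\<open>R_tilde_sum_eq_stencil\<close>, \<open>R_tilde_diff_eq_stencil\<close>). By parity every second term
  of the Taylor expansion at \<open>c\<close> drops out, which gives
  \<open>m = u(c) + O(\<tau>\<^sup>2)\<close>, \<open>\<Delta>m = \<Delta>u(c) + O(\<tau>\<^sup>2)\<close> and \<open>d = \<tau> u\<^sub>t(c) + O(\<tau>\<^sup>3)\<close>
  (\<open>mean_stencil_error\<close>, \<open>laplacian_stencil_error\<close>, \<open>diff_stencil_error\<close>).

  For the cubic term the parallelogram law gives \<open>|R'|\<^sup>2 + |R|\<^sup>2 = 2|m|\<^sup>2 + |d|\<^sup>2/2\<close>, so that this term equals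
  \<open>\<lambda>|m|\<^sup>2m + \<lambda>|d|\<^sup>2m/4\<close>. The first part differs from \<open>\<lambda>|u(c)|\<^sup>2u(c)\<close> by \<open>O(\<tau>\<^sup>2)\<close> because the cubic
  map is Lipschitz on bounded sets, and the second part is \<open>O(\<tau>\<^sup>2)\<close> because \<open>d = O(\<tau>)\<close>. What remains
  at \<open>c\<close> is the left-hand side of the differential equation, which vanishes
  (\<open>trunc_error_uniform_bound\<close>). All constants depend only on the suprema of finitely many
  derivatives of \<open>u\<close> on the compact closed cylinder, hence not on \<open>x\<close>, \<open>\<tau>\<close> or \<open>n\<close>.

  The outermost nodes \<open>c \<plusminus> 2\<tau>\<close> may be the times \<open>0\<close> and \<open>T\<close>, where the derivatives of \<open>u\<close> are only
  limits from inside. These limits are genuine derivatives: one-sided ones in time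
  (\<open>smooth_time_derivative\<close>) and two-sided ones in space, at interior points of \<open>D\<close>
  (\<open>smooth_slice_derivative\<close>).
\<close>

section \<open>Taylor's formula on a closed interval\<close>

lemma has_vector_derivative_from_increment:
  assumes "((\<lambda>h. f (s + h)) has_vector_derivative d) (at 0)"
  shows "(f has_vector_derivative d) (at s)"
proof -
  have shift: "((\<lambda>r. r - s) has_vector_derivative 1) (at s)"
    using has_vector_derivative_diff[OF has_vector_derivative_id
        has_vector_derivative_const[of s], of "at s"] by simp
  from vector_diff_chain_at[OF shift, of "\<lambda>h. f (s + h)" d] assms
  show ?thesis by (simp add: o_def)
qed

text \<open>
  The fundamental theorem of calculus needs the derivative only in the open interval; the
  indefinite integral of the continuous \<open>g'\<close> is then differentiable at the end points as well.
\<close>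

lemma has_vector_derivative_up_to_endpoints:
  fixes g g' :: "real \<Rightarrow> 'b::banach"
  assumes "continuous_on {a..b} g" and g': "continuous_on {a..b} g'"
    and der: "\<And>t. t \<in> {a<..<b} \<Longrightarrow> (g has_vector_derivative g' t) (at t)"
    and t: "t \<in> {a..b}"
  shows "(g has_vector_derivative g' t) (at t within {a..b})"
proof -
  have g: "g s = g a + integral {a..s} g'" if s: "s \<in> {a..b}" for s
  proof -
    have "(g' has_integral (g s - g a)) {a..s}"
    proof (rule fundamental_theorem_of_calculus_interior)
      show "a \<le> s" using s by auto
      show "continuous_on {a..s} g"
        using s by (intro continuous_on_subset[OF assms(1)]) auto
      show "(g has_vector_derivative g' x) (at x)" if "x \<in> {a<..<s}" for x
        using that s by (intro der) auto
    qed
    then show ?thesis by (simp add: integral_unique)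
  qed
  have "((\<lambda>s. g a + integral {a..s} g') has_vector_derivative g' t) (at t within {a..b})"
    using has_vector_derivative_add[OF has_vector_derivative_const
        integral_has_vector_derivative[OF g' t]] by simp
  then show ?thesis
    by (intro has_vector_derivative_transform[OF t g])
qed

text \<open>
  Stated for vector values, where no mean value theorem in equality form holds; so the remainder
  is not identified but estimated, by induction: the derivative of the remainder of order \<open>n + 1\<close> is
  the remainder of order \<open>n\<close> for \<open>f'\<close>. Bounding it by its largest value on the segment, rather than
  integrating, loses the factorial but keeps the order.
\<close>

lemma vector_Taylor_bound:
  fixes f :: "nat \<Rightarrow> real \<Rightarrow> 'b::real_normed_vector"
  assumes "convex S"
    and "\<And>i t. i \<le> n \<Longrightarrow> t \<in> S \<Longrightarrow> (f i has_vector_derivative f (Suc i) t) (at t within S)"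
    and "\<And>t. t \<in> S \<Longrightarrow> norm (f (Suc n) t) \<le> B"
    and "w \<in> S" "z \<in> S"
  shows "norm (f 0 z - (\<Sum>i\<le>n. ((z - w) ^ i / fact i) *\<^sub>R f i w)) \<le> B * \<bar>z - w\<bar> ^ Suc n"
  using assms(2,3,5)
proof (induction n arbitrary: f z)
  case 0
  have "norm (f 0 z - f 0 w) \<le> B * norm (z - w)"
  proof (rule differentiable_bound[OF assms(1)])
    show "(f 0 has_derivative (\<lambda>h. h *\<^sub>R f (Suc 0) t)) (at t within S)" if "t \<in> S" for t
      using 0(1)[of 0 t] that by (simp add: has_vector_derivative_def)
    show "onorm (\<lambda>h. h *\<^sub>R f (Suc 0) t) \<le> B" if "t \<in> S" for t
      using 0(2)[OF that] by (simp add: onorm_scaleR_left onorm_id)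
  qed (use 0 assms in auto)
  then show ?case by simp
next
  case (Suc n)
  define \<phi> where "\<phi> t = f 0 t - (\<Sum>i\<le>Suc n. ((t - w) ^ i / fact i) *\<^sub>R f i w)" for t
  define \<phi>' where "\<phi>' t = f 1 t - (\<Sum>i\<le>n. ((t - w) ^ i / fact i) *\<^sub>R f (Suc i) w)" for t
  have B: "0 \<le> B" using Suc.prems(2)[OF assms(4)] norm_ge_zero order_trans by blast
  have \<phi>': "norm (\<phi>' t) \<le> B * \<bar>t - w\<bar> ^ Suc n" if "t \<in> S" for t
    unfolding \<phi>'_def using Suc.IH[of "\<lambda>i. f (Suc i)" t] Suc.prems that by simp
  have seg: "closed_segment w z \<subseteq> S"
    using assms(1,4) Suc.prems(3) by (simp add: closed_segment_subset)
  have der: "(\<phi> has_vector_derivative \<phi>' t) (at t within S)" if t: "t \<in> S" for t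
  proof -
    have pow: "((\<lambda>s. ((s - w) ^ Suc i / fact (Suc i)) *\<^sub>R f (Suc i) w) has_vector_derivative
           ((t - w) ^ i / fact i) *\<^sub>R f (Suc i) w) (at t within S)" for i
    proof -
      have "((\<lambda>s. (s - w) ^ Suc i / fact (Suc i)) has_real_derivative
            (real (Suc i) * (t - w) ^ i) / fact (Suc i)) (at t within S)"
        by (rule derivative_eq_intros refl | simp)+
      moreover have "(real (Suc i) * (t - w) ^ i) / fact (Suc i) = (t - w) ^ i / fact i"
        by (simp add: field_simps del: of_nat_Suc)
      ultimately have "((\<lambda>s. (s - w) ^ Suc i / fact (Suc i)) has_real_derivative
            (t - w) ^ i / fact i) (at t within S)" by metis
      from has_vector_derivative_scaleR[OF this has_vector_derivative_const[of "f (Suc i) w"]]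
      show ?thesis by simp
    qed
    have "((\<lambda>s. f 0 s - (f 0 w + (\<Sum>i\<le>n. ((s - w) ^ Suc i / fact (Suc i)) *\<^sub>R f (Suc i) w)))
        has_vector_derivative f 1 t - (0 + (\<Sum>i\<le>n. ((t - w) ^ i / fact i) *\<^sub>R f (Suc i) w)))
        (at t within S)"
      using Suc.prems(1)[of 0 t] t
      by (intro has_vector_derivative_diff has_vector_derivative_add
          has_vector_derivative_const has_vector_derivative_sum pow) auto
    then show ?thesis
      unfolding \<phi>_def \<phi>'_def sum.atMost_Suc_shift by simp
  qed
  have "norm (\<phi> z - \<phi> w) \<le> (B * \<bar>z - w\<bar> ^ Suc n) * norm (z - w)"
  proof (rule differentiable_bound[of "closed_segment w z"])
    show "(\<phi> has_derivative (\<lambda>h. h *\<^sub>R \<phi>' t)) (at t within closed_segment w z)"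
      if "t \<in> closed_segment w z" for t
      using der[of t] that seg has_derivative_subset
      unfolding has_vector_derivative_def by blast
    show "onorm (\<lambda>h. h *\<^sub>R \<phi>' t) \<le> B * \<bar>z - w\<bar> ^ Suc n" if t: "t \<in> closed_segment w z" for t
    proof -
      have "\<bar>t - w\<bar> \<le> \<bar>z - w\<bar>"
        using t by (auto simp: closed_segment_eq_real_ivl split: if_splits)
      then have "B * \<bar>t - w\<bar> ^ Suc n \<le> B * \<bar>z - w\<bar> ^ Suc n"
        using B by (intro mult_left_mono power_mono) auto
      with \<phi>'[of t] t seg show ?thesis
        by (fastforce simp: onorm_scaleR_left onorm_id)
    qed
  qed auto
  moreover have "\<phi> w = 0"
    unfolding \<phi>_def sum.atMost_Suc_shift by simp
  ultimately show ?case by (simp add: \<phi>_def mult_ac)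
qed

text \<open>
  A stencil acts on a function, up to the remainder, through its moments \<open>\<Sum>k a\<^sub>k k\<^sup>i\<close> only. The order
  of accuracy of a finite difference formula is thereby reduced to arithmetic on its weights.
\<close>

lemma stencil_Taylor_bound:
  fixes f :: "nat \<Rightarrow> real \<Rightarrow> 'b::real_normed_vector" and a :: "int \<Rightarrow> real"
  assumes "convex S"
    and "\<And>i t. i \<le> n \<Longrightarrow> t \<in> S \<Longrightarrow> (f i has_vector_derivative f (Suc i) t) (at t within S)"
    and "\<And>t. t \<in> S \<Longrightarrow> norm (f (Suc n) t) \<le> B"
    and "c \<in> S" and K: "\<And>k. k \<in> K \<Longrightarrow> c + of_int k * \<tau> \<in> S"
  shows "norm ((\<Sum>k\<in>K. a k *\<^sub>R f 0 (c + of_int k * \<tau>))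
           - (\<Sum>i\<le>n. ((\<Sum>k\<in>K. a k * of_int k ^ i) * \<tau> ^ i / fact i) *\<^sub>R f i c))
         \<le> (\<Sum>k\<in>K. \<bar>a k\<bar> * \<bar>of_int k\<bar> ^ Suc n) * B * \<bar>\<tau>\<bar> ^ Suc n"
proof -
  have "(\<Sum>i\<le>n. ((\<Sum>k\<in>K. a k * of_int k ^ i) * \<tau> ^ i / fact i) *\<^sub>R f i c)
      = (\<Sum>i\<le>n. \<Sum>k\<in>K. a k *\<^sub>R (((of_int k * \<tau>) ^ i / fact i) *\<^sub>R f i c))"
    by (simp add: sum_distrib_right sum_distrib_left sum_divide_distrib scaleR_sum_left power_mult_distrib mult_ac)
  also have "\<dots> = (\<Sum>k\<in>K. a k *\<^sub>R (\<Sum>i\<le>n. ((of_int k * \<tau>) ^ i / fact i) *\<^sub>R f i c))"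
    by (subst sum.swap) (simp add: scaleR_sum_right)
  finally have "norm ((\<Sum>k\<in>K. a k *\<^sub>R f 0 (c + of_int k * \<tau>))
           - (\<Sum>i\<le>n. ((\<Sum>k\<in>K. a k * of_int k ^ i) * \<tau> ^ i / fact i) *\<^sub>R f i c))
      = norm (\<Sum>k\<in>K. a k *\<^sub>R (f 0 (c + of_int k * \<tau>)
             - (\<Sum>i\<le>n. ((of_int k * \<tau>) ^ i / fact i) *\<^sub>R f i c)))"
    by (simp add: scaleR_diff_right sum_subtractf)
  also have "\<dots> \<le> (\<Sum>k\<in>K. \<bar>a k\<bar> * (B * \<bar>of_int k * \<tau>\<bar> ^ Suc n))"
  proof (rule sum_norm_le)
    fix k assume "k \<in> K"
    then show "norm (a k *\<^sub>R (f 0 (c + of_int k * \<tau>)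
             - (\<Sum>i\<le>n. ((of_int k * \<tau>) ^ i / fact i) *\<^sub>R f i c)))
        \<le> \<bar>a k\<bar> * (B * \<bar>of_int k * \<tau>\<bar> ^ Suc n)"
      using vector_Taylor_bound[OF assms(1-4) K[of k]]
      by (simp add: mult_left_mono del: power_Suc)
  qed
  also have "\<dots> = (\<Sum>k\<in>K. \<bar>a k\<bar> * \<bar>of_int k\<bar> ^ Suc n) * B * \<bar>\<tau>\<bar> ^ Suc n"
    by (simp add: sum_distrib_right sum_distrib_left abs_mult power_mult_distrib mult_ac)
  finally show ?thesis .
qed

section \<open>Functions smooth up to the boundary of a cylinder\<close>

lemma smooth_has_partial_derivs:
  assumes "smooth_up_to_boundary U u" "bs \<in> lists Basis" "e \<in> Basis" "p \<in> U"
  shows "((\<lambda>s. partial_derivs_cl U bs u (p + s *\<^sub>R e)) has_vector_derivative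
           partial_derivs_cl U (e # bs) u p) (at 0)"
  using assms
  by (simp add: smooth_up_to_boundary_def partial_deriv_cl_def partial_deriv_def
      flip: vector_derivative_works)

lemma smooth_continuous_on_closure:
  assumes "smooth_up_to_boundary U u" "bs \<in> lists Basis"
  shows "continuous_on (closure U) (partial_derivs_cl U bs u)"
  using assms by (simp add: smooth_up_to_boundary_def)

lemma smooth_derivs_bounded:
  fixes U :: "'a::euclidean_space set"
  assumes "smooth_up_to_boundary U u" "bs \<in> lists Basis" "bounded U"
  obtains M where "\<And>p. p \<in> closure U \<Longrightarrow> norm (partial_derivs_cl U bs u p) \<le> M"
proof -
  have "compact (partial_derivs_cl U bs u ` closure U)"
    using assms by (intro compact_continuous_image smooth_continuous_on_closure)
      (auto simp: compact_closure)
  then have "bounded (partial_derivs_cl U bs u ` closure U)" by (rule compact_imp_bounded)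
  then show ?thesis using that by (auto simp: bounded_iff)
qed

lemma closure_cylinder: "T > 0 \<Longrightarrow> closure (cylinder D T) = closure D \<times> {0..T}"
  by (simp add: closure_Times)

lemma smooth_time_derivative:
  fixes u :: "'a::euclidean_space \<times> real \<Rightarrow> 'b::banach"
  assumes sm: "smooth_up_to_boundary (cylinder D T) u" and T: "T > 0" and bs: "bs \<in> lists Basis"
    and x: "x \<in> D" and t: "t \<in> {0..T}"
  shows "((\<lambda>t. partial_derivs_cl (cylinder D T) bs u (x, t)) has_vector_derivative
           partial_derivs_cl (cylinder D T) ((0, 1) # bs) u (x, t)) (at t within {0..T})"
proof (rule has_vector_derivative_up_to_endpoints[OF _ _ _ t,
    where g' = "\<lambda>t. partial_derivs_cl (cylinder D T) ((0, 1) # bs) u (x, t)"])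
  have e: "(0, 1) \<in> (Basis :: ('a \<times> real) set)" by (simp add: Basis_prod_def)
  have cont: "continuous_on {0..T} (\<lambda>t. partial_derivs_cl (cylinder D T) cs u (x, t))"
    if "cs \<in> lists Basis" for cs
  proof (rule continuous_on_compose2[OF smooth_continuous_on_closure[OF sm that]])
    show "(\<lambda>t. (x, t)) ` {0..T} \<subseteq> closure (cylinder D T)"
      using x closure_subset[of D] by (auto simp: closure_cylinder[OF T])
  qed (intro continuous_intros)
  show "continuous_on {0..T} (\<lambda>t. partial_derivs_cl (cylinder D T) bs u (x, t))"
    by (rule cont[OF bs])
  show "continuous_on {0..T} (\<lambda>t. partial_derivs_cl (cylinder D T) ((0, 1) # bs) u (x, t))"
    using e bs by (intro cont) auto
  show "((\<lambda>t. partial_derivs_cl (cylinder D T) bs u (x, t)) has_vector_derivative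
           partial_derivs_cl (cylinder D T) ((0, 1) # bs) u (x, s)) (at s)"
    if s: "s \<in> {0<..<T}" for s
  proof -
    have "((\<lambda>r. partial_derivs_cl (cylinder D T) bs u (x, s + r)) has_vector_derivative
           partial_derivs_cl (cylinder D T) ((0, 1) # bs) u (x, s)) (at 0)"
      using smooth_has_partial_derivs[OF sm bs e, of "(x, s)"] x s by simp
    then show ?thesis by (rule has_vector_derivative_from_increment)
  qed
qed

text \<open>
  Only the times \<open>t = 0\<close> and \<open>t = T\<close> are problematic. At interior times the mean value inequality
  bounds the increment error by \<open>\<epsilon>|s|\<close> for all \<open>|s|\<close> below a threshold that uniform continuity
  of the derivative makes independent of the time; so the bound survives the limit to the
  end points.
\<close>

lemma smooth_slice_derivative:
  fixes u :: "'a::euclidean_space \<times> real \<Rightarrow> 'b::banach"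
  assumes sm: "smooth_up_to_boundary (cylinder D T) u" and T: "T > 0" and D: "open D"
    and bs: "bs \<in> lists Basis" and b: "b \<in> Basis" and x: "x \<in> D" and t: "t \<in> {0..T}"
  shows "((\<lambda>s. partial_derivs_cl (cylinder D T) bs u (x + s *\<^sub>R b, t)) has_vector_derivative
           partial_derivs_cl (cylinder D T) ((b, 0) # bs) u (x, t)) (at 0)"
proof -
  define F where "F = partial_derivs_cl (cylinder D T) bs u"
  define G where "G = partial_derivs_cl (cylinder D T) ((b, 0) # bs) u"
  have e: "(b, 0) \<in> (Basis :: ('a \<times> real) set)" using b by (simp add: Basis_prod_def)
  obtain \<delta> where \<delta>: "\<delta> > 0" "cball x \<delta> \<subseteq> D"
    using D x open_contains_cball_eq by blast
  have sub: "cball x \<delta> \<times> {0..T} \<subseteq> closure (cylinder D T)"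
    using \<delta>(2) closure_subset[of D] by (auto simp: closure_cylinder[OF T])
  have contF: "continuous_on (cball x \<delta> \<times> {0..T}) F"
    unfolding F_def by (rule continuous_on_subset[OF smooth_continuous_on_closure[OF sm bs] sub])
  have "(b, 0) # bs \<in> lists Basis" using e bs by simp
  then have contG: "continuous_on (cball x \<delta> \<times> {0..T}) G"
    unfolding G_def by (rule continuous_on_subset[OF smooth_continuous_on_closure[OF sm] sub])
  have ucG: "uniformly_continuous_on (cball x \<delta> \<times> {0..T}) G"
    using contG by (intro compact_uniformly_continuous compact_Times) auto
  have line: "x + s *\<^sub>R b \<in> cball x \<delta>" if "\<bar>s\<bar> \<le> \<delta>" for s
    using that b by (simp add: dist_norm)
  have deriv: "((\<lambda>s. F (x + s *\<^sub>R b, r)) has_vector_derivative G (x + s *\<^sub>R b, r)) (at s)"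
    if r: "r \<in> {0<..<T}" and s: "\<bar>s\<bar> \<le> \<delta>" for r s
  proof -
    have "((\<lambda>h. F (x + (s + h) *\<^sub>R b, r)) has_vector_derivative G (x + s *\<^sub>R b, r)) (at 0)"
      using smooth_has_partial_derivs[OF sm bs e, of "(x + s *\<^sub>R b, r)"] line[OF s] \<delta>(2) r
      by (auto simp: F_def G_def scaleR_add_left add.assoc)
    then show ?thesis by (rule has_vector_derivative_from_increment)
  qed
  have "((\<lambda>s. F (x + s *\<^sub>R b, t)) has_derivative (\<lambda>h. h *\<^sub>R G (x, t))) (at 0)"
    unfolding has_derivative_within_alt
  proof (intro conjI allI impI)
    show "bounded_linear (\<lambda>h. h *\<^sub>R G (x, t))" by (rule bounded_linear_scaleR_left)
    fix \<epsilon> :: real assume "\<epsilon> > 0"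
    then obtain \<eta> where \<eta>: "\<eta> > 0"
      and close: "\<And>p q. p \<in> cball x \<delta> \<times> {0..T} \<Longrightarrow> q \<in> cball x \<delta> \<times> {0..T} \<Longrightarrow> dist q p < \<eta>
            \<Longrightarrow> dist (G q) (G p) < \<epsilon>"
      using ucG unfolding uniformly_continuous_on_def by metis
    have interior: "norm (F (x + s *\<^sub>R b, r) - F (x, r) - s *\<^sub>R G (x, r)) \<le> \<epsilon> * \<bar>s\<bar>"
      if r: "r \<in> {0<..<T}" and s: "\<bar>s\<bar> < min \<delta> \<eta>" for r s
    proof -
      have "norm ((F (x + s *\<^sub>R b, r) - s *\<^sub>R G (x, r)) - (F (x + 0 *\<^sub>R b, r) - 0 *\<^sub>R G (x, r)))
          \<le> \<epsilon> * norm (s - 0)"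
      proof (rule differentiable_bound[of "{-\<bar>s\<bar>..\<bar>s\<bar>}" "\<lambda>s. F (x + s *\<^sub>R b, r) - s *\<^sub>R G (x, r)"
            "\<lambda>q h. h *\<^sub>R (G (x + q *\<^sub>R b, r) - G (x, r))"])
        fix q assume q: "q \<in> {-\<bar>s\<bar>..\<bar>s\<bar>}"
        then have q': "\<bar>q\<bar> < \<eta>" "\<bar>q\<bar> \<le> \<delta>" using s by auto
        have "((\<lambda>s. s *\<^sub>R G (x, r)) has_vector_derivative G (x, r)) (at q within {-\<bar>s\<bar>..\<bar>s\<bar>})"
          using has_derivative_ident has_derivative_scaleR_left
          unfolding has_vector_derivative_def by blast
        from has_vector_derivative_diff[OF has_vector_derivative_at_within[OF deriv[OF r q'(2)]] this]
        show "((\<lambda>s. F (x + s *\<^sub>R b, r) - s *\<^sub>R G (x, r)) has_derivative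
               (\<lambda>h. h *\<^sub>R (G (x + q *\<^sub>R b, r) - G (x, r)))) (at q within {-\<bar>s\<bar>..\<bar>s\<bar>})"
          unfolding has_vector_derivative_def .
        have "dist (G (x + q *\<^sub>R b, r)) (G (x, r)) < \<epsilon>"
        proof (rule close)
          show "dist (x + q *\<^sub>R b, r) (x, r) < \<eta>"
            using q' b by (simp add: dist_Pair_Pair dist_norm)
        qed (use line q' r \<delta>(1) in auto)
        then show "onorm (\<lambda>h. h *\<^sub>R (G (x + q *\<^sub>R b, r) - G (x, r))) \<le> \<epsilon>"
          by (simp add: onorm_scaleR_left onorm_id dist_norm)
      qed auto
      then show ?thesis by (simp add: algebra_simps)
    qed
    have "norm (F (x + s *\<^sub>R b, t) - F (x, t) - s *\<^sub>R G (x, t)) \<le> \<epsilon> * \<bar>s\<bar>"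
      if s: "\<bar>s\<bar> < min \<delta> \<eta>" for s
    proof -
      define H where "H r = norm (F (x + s *\<^sub>R b, r) - F (x, r) - s *\<^sub>R G (x, r))" for r
      have "continuous_on {0..T} H"
        unfolding H_def using line[of s] s \<delta>(1)
        by (intro continuous_intros continuous_on_compose2[OF contF] continuous_on_compose2[OF contG])
          auto
      then have "continuous_on (closure {0<..<T}) H" using T by simp
      then show ?thesis
        using continuous_le_on_closure[of "{0<..<T}" H t "\<epsilon> * \<bar>s\<bar>"] interior s t T
        by (auto simp: H_def)
    qed
    then show "\<exists>d>0. \<forall>y\<in>UNIV. norm (y - 0) < d \<longrightarrow>
        norm (F (x + y *\<^sub>R b, t) - F (x + 0 *\<^sub>R b, t) - (y - 0) *\<^sub>R G (x, t)) \<le> \<epsilon> * norm (y - 0)"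
      using \<eta> \<delta>(1) by (intro exI[of _ "min \<delta> \<eta>"]) auto
  qed
  then show ?thesis by (simp add: has_vector_derivative_def F_def G_def)
qed

text \<open>
  The Laplacian of a combination of time slices is a nested pointwise derivative; the inner one
  has to be computed in a neighbourhood of \<open>x\<close>, which is where openness of \<open>D\<close> enters.
\<close>

lemma laplacian_sum_slices:
  fixes u :: "'a::euclidean_space \<times> real \<Rightarrow> complex"
  assumes sm: "smooth_up_to_boundary (cylinder D T) u" and T: "T > 0" and D: "open D"
    and x: "x \<in> D" and t: "\<And>k. k \<in> K \<Longrightarrow> t k \<in> {0..T}"
  shows "laplacian (\<lambda>y. \<Sum>k\<in>K. a k *\<^sub>R u (y, t k)) x
       = (\<Sum>k\<in>K. a k *\<^sub>R space_laplacian_cl (cylinder D T) u (x, t k))"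
proof -
  let ?F = "partial_derivs_cl (cylinder D T)"
  have der: "((\<lambda>s. \<Sum>k\<in>K. a k *\<^sub>R ?F bs u (y + s *\<^sub>R b, t k)) has_vector_derivative
           (\<Sum>k\<in>K. a k *\<^sub>R ?F ((b, 0) # bs) u (y, t k))) (at 0)"
    if "bs \<in> lists Basis" "b \<in> Basis" "y \<in> D" for bs b y
    using smooth_slice_derivative[OF sm T D that t]
      bounded_linear.has_vector_derivative[OF bounded_linear_scaleR_right]
    by (intro has_vector_derivative_sum) blast
  have "partial_deriv b (partial_deriv b (\<lambda>y. \<Sum>k\<in>K. a k *\<^sub>R u (y, t k))) x
      = (\<Sum>k\<in>K. a k *\<^sub>R ?F [(b, 0), (b, 0)] u (x, t k))" if b: "b \<in> Basis" for b
  proof -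
    have e: "(b, 0) \<in> (Basis :: ('a \<times> real) set)" using b by (simp add: Basis_prod_def)
    have first: "partial_deriv b (\<lambda>y. \<Sum>k\<in>K. a k *\<^sub>R u (y, t k)) y
        = (\<Sum>k\<in>K. a k *\<^sub>R ?F [(b, 0)] u (y, t k))" if "y \<in> D" for y
      unfolding partial_deriv_def using der[of "[]", OF _ b that]
      by (simp add: vector_derivative_at)
    define V where "V = (\<lambda>s. x + s *\<^sub>R b) -` D"
    have "open V" unfolding V_def
      using D by (intro open_vimage continuous_intros)
    moreover have "0 \<in> V" using x by (simp add: V_def)
    moreover have "[(b, 0)] \<in> lists (Basis :: ('a \<times> real) set)" using e by simp
    note second = der[OF this b x]
    ultimately have "((\<lambda>s. partial_deriv b (\<lambda>y. \<Sum>k\<in>K. a k *\<^sub>R u (y, t k)) (x + s *\<^sub>R b))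
        has_vector_derivative (\<Sum>k\<in>K. a k *\<^sub>R ?F [(b, 0), (b, 0)] u (x, t k))) (at 0)"
      by (intro has_vector_derivative_transform_within_open[OF second, of V])
        (auto simp: V_def first)
    then show ?thesis
      unfolding partial_deriv_def[of _ "partial_deriv _ _"] by (rule vector_derivative_at)
  qed
  then have "laplacian (\<lambda>y. \<Sum>k\<in>K. a k *\<^sub>R u (y, t k)) x
      = (\<Sum>b\<in>Basis. \<Sum>k\<in>K. a k *\<^sub>R ?F [(b, 0), (b, 0)] u (x, t k))"
    by (simp add: laplacian_def)
  also have "\<dots> = (\<Sum>k\<in>K. a k *\<^sub>R space_laplacian_cl (cylinder D T) u (x, t k))"
    by (subst sum.swap) (simp add: space_laplacian_cl_def scaleR_sum_right)
  finally show ?thesis .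
qed

text \<open>
  The constant is uniform in \<open>x\<close>, \<open>c\<close> and \<open>\<tau>\<close>, since the derivative in the remainder is bounded on
  the compact closed cylinder. The list \<open>bs\<close> allows for expanding spatial derivatives of \<open>u\<close> too.
\<close>

lemma smooth_stencil_expansion:
  fixes u :: "'a::euclidean_space \<times> real \<Rightarrow> 'b::banach" and a :: "int \<Rightarrow> real"
  assumes sm: "smooth_up_to_boundary (cylinder D T) u" and T: "T > 0" and D: "bounded D"
    and bs: "bs \<in> lists Basis"
  obtains C where "C \<ge> 0" and
    "\<And>x c \<tau>. x \<in> D \<Longrightarrow> \<tau> > 0 \<Longrightarrow> c \<in> {0..T} \<Longrightarrow> (\<And>k. k \<in> K \<Longrightarrow> c + of_int k * \<tau> \<in> {0..T}) \<Longrightarrow>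
       norm ((\<Sum>k\<in>K. a k *\<^sub>R partial_derivs_cl (cylinder D T) bs u (x, c + of_int k * \<tau>))
           - (\<Sum>i\<le>n. ((\<Sum>k\<in>K. a k * of_int k ^ i) * \<tau> ^ i / fact i) *\<^sub>R
               partial_derivs_cl (cylinder D T) (replicate i (0, 1) @ bs) u (x, c)))
         \<le> C * \<tau> ^ Suc n"
proof -
  let ?F = "\<lambda>i. partial_derivs_cl (cylinder D T) (replicate i (0, 1) @ bs) u"
  have bs': "replicate i (0, 1) @ bs \<in> lists Basis" for i
    using bs by (auto simp: Basis_prod_def)
  have "bounded (cylinder D T)" using D by (intro bounded_Times) auto
  with smooth_derivs_bounded[OF sm bs'[of "Suc n"]]
  obtain M where M: "\<And>p. p \<in> closure (cylinder D T) \<Longrightarrow> norm (?F (Suc n) p) \<le> M"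
    by blast
  have bound: "norm ((\<Sum>k\<in>K. a k *\<^sub>R ?F 0 (x, c + of_int k * \<tau>))
           - (\<Sum>i\<le>n. ((\<Sum>k\<in>K. a k * of_int k ^ i) * \<tau> ^ i / fact i) *\<^sub>R ?F i (x, c)))
         \<le> ((\<Sum>k\<in>K. \<bar>a k\<bar> * \<bar>of_int k\<bar> ^ Suc n) * \<bar>M\<bar>) * \<tau> ^ Suc n"
    if x: "x \<in> D" and \<tau>: "\<tau> > 0" and c: "c \<in> {0..T}"
      and K: "\<And>k. k \<in> K \<Longrightarrow> c + of_int k * \<tau> \<in> {0..T}" for x c \<tau>
  proof -
    have "norm ((\<Sum>k\<in>K. a k *\<^sub>R ?F 0 (x, c + of_int k * \<tau>))
           - (\<Sum>i\<le>n. ((\<Sum>k\<in>K. a k * of_int k ^ i) * \<tau> ^ i / fact i) *\<^sub>R ?F i (x, c)))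
         \<le> (\<Sum>k\<in>K. \<bar>a k\<bar> * \<bar>of_int k\<bar> ^ Suc n) * \<bar>M\<bar> * \<bar>\<tau>\<bar> ^ Suc n"
    proof (rule stencil_Taylor_bound[where f = "\<lambda>i t. ?F i (x, t)" and S = "{0..T}"])
      show "((\<lambda>t. ?F i (x, t)) has_vector_derivative ?F (Suc i) (x, t)) (at t within {0..T})"
        if "t \<in> {0..T}" for i t
        using smooth_time_derivative[OF sm T bs' x that, of i] by simp
      show "norm (?F (Suc n) (x, t)) \<le> \<bar>M\<bar>" if "t \<in> {0..T}" for t
      proof -
        have "(x, t) \<in> closure (cylinder D T)"
          using x closure_subset[of D] that by (auto simp: closure_cylinder[OF T])
        from M[OF this] show ?thesis by linarith
      qed
    qed (use c K in auto)
    then show ?thesis using \<tau> by simp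
  qed
  show ?thesis
  proof (rule that)
    show "0 \<le> (\<Sum>k\<in>K. \<bar>a k\<bar> * \<bar>of_int k\<bar> ^ Suc n) * \<bar>M\<bar>"
      by (intro mult_nonneg_nonneg sum_nonneg) auto
  qed (use bound in simp)
qed

section \<open>The scheme as a pair of centred stencils\<close>

text \<open>
  The weights of \<open>(R' + R)/2\<close> and of \<open>R' - R\<close>: half the sum, and the difference, of
  \<open>(-1, 7, 7, -1, 0)/12\<close> and \<open>(0, -1, 7, 7, -1)/12\<close>, listed from \<open>k = 2\<close> down to \<open>k = -2\<close>. They are meant
  for \<open>|k| \<le> 2\<close> only.
\<close>

definition mean_weight :: "int \<Rightarrow> real" where
  "mean_weight k = (if k = 0 then 7/12 else if \<bar>k\<bar> = 1 then 1/4 else -1/24)"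

definition diff_weight :: "int \<Rightarrow> real" where
  "diff_weight k = (if \<bar>k\<bar> = 1 then 2/3 * of_int k else - (1/24) * of_int k)"

lemma stencil_indices: "{-2..2::int} = {-2, -1, 0, 1, 2}"
  by auto

abbreviation stencil ::
    "(int \<Rightarrow> real) \<Rightarrow> ('a \<times> real \<Rightarrow> 'b::real_normed_vector) \<Rightarrow> 'a \<Rightarrow> real \<Rightarrow> real \<Rightarrow> 'b" where
  "stencil a f x c \<tau> \<equiv> (\<Sum>k\<in>{-2..2}. a k *\<^sub>R f (x, c + of_int k * \<tau>))"

lemma stencil_nodes:
  fixes c \<tau> T :: real
  assumes "\<tau> > 0" "2 * \<tau> \<le> c" "c + 2 * \<tau> \<le> T" "k \<in> {-2..2}"
  shows "c + of_int k * \<tau> \<in> {0..T}"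
proof -
  have "-2 \<le> real_of_int k" "real_of_int k \<le> 2" using assms(4) by auto
  then have "-2 * \<tau> \<le> of_int k * \<tau>" "of_int k * \<tau> \<le> 2 * \<tau>"
    using assms(1) by (intro mult_right_mono; linarith)+
  then have "0 \<le> c + of_int k * \<tau>" "c + of_int k * \<tau> \<le> T"
    using assms by linarith+
  then show ?thesis by simp
qed

text \<open>The weights sum to \<open>1\<close>, and their first moment vanishes because they are even.\<close>

lemma mean_stencil_error:
  fixes u :: "'a::euclidean_space \<times> real \<Rightarrow> 'b::banach"
  assumes "smooth_up_to_boundary (cylinder D T) u" "T > 0" "bounded D" "bs \<in> lists Basis"
  obtains C where "C \<ge> 0" and
    "\<And>x c \<tau>. x \<in> D \<Longrightarrow> \<tau> > 0 \<Longrightarrow> 2 * \<tau> \<le> c \<Longrightarrow> c + 2 * \<tau> \<le> T \<Longrightarrow>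
       norm (stencil mean_weight (partial_derivs_cl (cylinder D T) bs u) x c \<tau>
           - partial_derivs_cl (cylinder D T) bs u (x, c)) \<le> C * \<tau>\<^sup>2"
proof -
  obtain C where "C \<ge> 0" and C:
    "\<And>x c \<tau>. x \<in> D \<Longrightarrow> \<tau> > 0 \<Longrightarrow> c \<in> {0..T} \<Longrightarrow>
       (\<And>k. k \<in> {-2..2} \<Longrightarrow> c + of_int k * \<tau> \<in> {0..T}) \<Longrightarrow>
       norm (stencil mean_weight (partial_derivs_cl (cylinder D T) bs u) x c \<tau>
           - (\<Sum>i\<le>1. ((\<Sum>k\<in>{-2..2}. mean_weight k * of_int k ^ i) * \<tau> ^ i / fact i) *\<^sub>R
               partial_derivs_cl (cylinder D T) (replicate i (0, 1) @ bs) u (x, c)))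
         \<le> C * \<tau> ^ Suc 1"
    using smooth_stencil_expansion[OF assms, of "{-2..2}" mean_weight 1] by blast
  have "norm (stencil mean_weight (partial_derivs_cl (cylinder D T) bs u) x c \<tau>
           - partial_derivs_cl (cylinder D T) bs u (x, c)) \<le> C * \<tau>\<^sup>2"
    if "x \<in> D" "\<tau> > 0" "2 * \<tau> \<le> c" "c + 2 * \<tau> \<le> T" for x c \<tau>
    using C[OF that(1,2) _ stencil_nodes[OF that(2-4)]] that
    by (simp add: stencil_indices mean_weight_def power2_eq_square)
  with \<open>C \<ge> 0\<close> that show ?thesis by blast
qed

text \<open>
  The weights have first moment \<open>1\<close>, and their moments of order \<open>0\<close> and \<open>2\<close> vanish because they are
  odd. The error is of third order, as it has to be before the division by \<open>\<tau>\<close> in the scheme.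
\<close>

lemma diff_stencil_error:
  fixes u :: "'a::euclidean_space \<times> real \<Rightarrow> 'b::banach"
  assumes "smooth_up_to_boundary (cylinder D T) u" "T > 0" "bounded D" "bs \<in> lists Basis"
  obtains C where "C \<ge> 0" and
    "\<And>x c \<tau>. x \<in> D \<Longrightarrow> \<tau> > 0 \<Longrightarrow> 2 * \<tau> \<le> c \<Longrightarrow> c + 2 * \<tau> \<le> T \<Longrightarrow>
       norm (stencil diff_weight (partial_derivs_cl (cylinder D T) bs u) x c \<tau>
           - \<tau> *\<^sub>R partial_derivs_cl (cylinder D T) ((0, 1) # bs) u (x, c)) \<le> C * \<tau> ^ 3"
proof -
  obtain C where "C \<ge> 0" and C:
    "\<And>x c \<tau>. x \<in> D \<Longrightarrow> \<tau> > 0 \<Longrightarrow> c \<in> {0..T} \<Longrightarrow>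
       (\<And>k. k \<in> {-2..2} \<Longrightarrow> c + of_int k * \<tau> \<in> {0..T}) \<Longrightarrow>
       norm (stencil diff_weight (partial_derivs_cl (cylinder D T) bs u) x c \<tau>
           - (\<Sum>i\<le>2. ((\<Sum>k\<in>{-2..2}. diff_weight k * of_int k ^ i) * \<tau> ^ i / fact i) *\<^sub>R
               partial_derivs_cl (cylinder D T) (replicate i (0, 1) @ bs) u (x, c)))
         \<le> C * \<tau> ^ Suc 2"
    using smooth_stencil_expansion[OF assms, of "{-2..2}" diff_weight 2] by blast
  have "norm (stencil diff_weight (partial_derivs_cl (cylinder D T) bs u) x c \<tau>
           - \<tau> *\<^sub>R partial_derivs_cl (cylinder D T) ((0, 1) # bs) u (x, c)) \<le> C * \<tau> ^ 3"
    if "x \<in> D" "\<tau> > 0" "2 * \<tau> \<le> c" "c + 2 * \<tau> \<le> T" for x c \<tau>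
    using C[OF that(1,2) _ stencil_nodes[OF that(2-4)]] that
    by (simp add: stencil_indices diff_weight_def eval_nat_numeral)
  with \<open>C \<ge> 0\<close> that show ?thesis by blast
qed

text \<open>
  The first-order bound is what the term \<open>|d|\<^sup>2m\<close> of the nonlinearity needs.
\<close>

lemma diff_stencil_bound:
  fixes u :: "'a::euclidean_space \<times> real \<Rightarrow> 'b::banach"
  assumes "smooth_up_to_boundary (cylinder D T) u" "T > 0" "bounded D" "bs \<in> lists Basis"
  obtains C where "C \<ge> 0" and
    "\<And>x c \<tau>. x \<in> D \<Longrightarrow> \<tau> > 0 \<Longrightarrow> 2 * \<tau> \<le> c \<Longrightarrow> c + 2 * \<tau> \<le> T \<Longrightarrow>
       norm (stencil diff_weight (partial_derivs_cl (cylinder D T) bs u) x c \<tau>) \<le> C * \<tau>"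
proof -
  obtain C where "C \<ge> 0" and C:
    "\<And>x c \<tau>. x \<in> D \<Longrightarrow> \<tau> > 0 \<Longrightarrow> c \<in> {0..T} \<Longrightarrow>
       (\<And>k. k \<in> {-2..2} \<Longrightarrow> c + of_int k * \<tau> \<in> {0..T}) \<Longrightarrow>
       norm (stencil diff_weight (partial_derivs_cl (cylinder D T) bs u) x c \<tau>
           - (\<Sum>i\<le>0. ((\<Sum>k\<in>{-2..2}. diff_weight k * of_int k ^ i) * \<tau> ^ i / fact i) *\<^sub>R
               partial_derivs_cl (cylinder D T) (replicate i (0, 1) @ bs) u (x, c)))
         \<le> C * \<tau> ^ Suc 0"
    using smooth_stencil_expansion[OF assms, of "{-2..2}" diff_weight 0] by blast
  have "norm (stencil diff_weight (partial_derivs_cl (cylinder D T) bs u) x c \<tau>) \<le> C * \<tau>"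
    if "x \<in> D" "\<tau> > 0" "2 * \<tau> \<le> c" "c + 2 * \<tau> \<le> T" for x c \<tau>
    using C[OF that(1,2) _ stencil_nodes[OF that(2-4)]] that
    by (simp add: stencil_indices diff_weight_def)
  with \<open>C \<ge> 0\<close> that show ?thesis by blast
qed

lemma laplacian_stencil_error:
  fixes u :: "'a::euclidean_space \<times> real \<Rightarrow> complex"
  assumes sm: "smooth_up_to_boundary (cylinder D T) u" and T: "T > 0" and D: "bounded D"
  obtains C where "C \<ge> 0" and
    "\<And>x c \<tau>. x \<in> D \<Longrightarrow> \<tau> > 0 \<Longrightarrow> 2 * \<tau> \<le> c \<Longrightarrow> c + 2 * \<tau> \<le> T \<Longrightarrow>
       cmod (stencil mean_weight (space_laplacian_cl (cylinder D T) u) x c \<tau>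
           - space_laplacian_cl (cylinder D T) u (x, c)) \<le> C * \<tau>\<^sup>2"
proof -
  let ?F = "\<lambda>b. partial_derivs_cl (cylinder D T) [(b, 0), (b, 0)] u"
  define P where "P b C \<longleftrightarrow> C \<ge> 0 \<and>
      (\<forall>x c \<tau>. x \<in> D \<longrightarrow> \<tau> > 0 \<longrightarrow> 2 * \<tau> \<le> c \<longrightarrow> c + 2 * \<tau> \<le> T \<longrightarrow>
        cmod (stencil mean_weight (?F b) x c \<tau> - ?F b (x, c)) \<le> C * \<tau>\<^sup>2)" for b C
  have "\<exists>C. P b C" if "b \<in> Basis" for b
  proof -
    have "[(b, 0), (b, 0)] \<in> lists (Basis :: ('a \<times> real) set)"
      using that by (simp add: Basis_prod_def)
    from mean_stencil_error[OF sm T D this] obtain C where "C \<ge> 0" and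
      "\<And>x c \<tau>. x \<in> D \<Longrightarrow> \<tau> > 0 \<Longrightarrow> 2 * \<tau> \<le> c \<Longrightarrow> c + 2 * \<tau> \<le> T \<Longrightarrow>
        cmod (stencil mean_weight (?F b) x c \<tau> - ?F b (x, c)) \<le> C * \<tau>\<^sup>2"
      by blast
    then have "P b C" by (simp add: P_def)
    then show ?thesis ..
  qed
  then obtain C where P: "\<And>b. b \<in> Basis \<Longrightarrow> P b (C b)" by metis
  have C: "cmod (stencil mean_weight (?F b) x c \<tau> - ?F b (x, c)) \<le> C b * \<tau>\<^sup>2"
    if "b \<in> Basis" "x \<in> D" "\<tau> > 0" "2 * \<tau> \<le> c" "c + 2 * \<tau> \<le> T" for b x c \<tau>
    using P[OF that(1)] that unfolding P_def by blast
  have "cmod (stencil mean_weight (space_laplacian_cl (cylinder D T) u) x c \<tau>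
           - space_laplacian_cl (cylinder D T) u (x, c)) \<le> (\<Sum>b\<in>Basis. C b) * \<tau>\<^sup>2"
    if "x \<in> D" "\<tau> > 0" "2 * \<tau> \<le> c" "c + 2 * \<tau> \<le> T" for x c \<tau>
  proof -
    have "stencil mean_weight (space_laplacian_cl (cylinder D T) u) x c \<tau>
        = (\<Sum>b\<in>Basis. stencil mean_weight (?F b) x c \<tau>)"
      by (subst sum.swap) (simp add: space_laplacian_cl_def scaleR_sum_right)
    then have "cmod (stencil mean_weight (space_laplacian_cl (cylinder D T) u) x c \<tau>
           - space_laplacian_cl (cylinder D T) u (x, c))
        = cmod (\<Sum>b\<in>Basis. stencil mean_weight (?F b) x c \<tau> - ?F b (x, c))"
      by (simp add: space_laplacian_cl_def sum_subtractf)
    also have "\<dots> \<le> (\<Sum>b\<in>Basis. C b * \<tau>\<^sup>2)"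
      using that by (intro sum_norm_le C)
    finally show ?thesis by (simp add: sum_distrib_right)
  qed
  moreover have "(\<Sum>b\<in>Basis. C b) \<ge> 0" using P by (simp add: P_def sum_nonneg)
  ultimately show ?thesis using that by blast
qed

lemma R_tilde_sum_eq_stencil:
  "R_tilde u \<tau> (n + 1) x + R_tilde u \<tau> n x
     = 2 * stencil mean_weight u x ((real n - 1) * \<tau>) \<tau>"
  by (simp add: R_tilde_def stencil_indices mean_weight_def scaleR_conv_of_real algebra_simps)

lemma R_tilde_diff_eq_stencil:
  "R_tilde u \<tau> (n + 1) x - R_tilde u \<tau> n x
     = stencil diff_weight u x ((real n - 1) * \<tau>) \<tau>"
  by (simp add: R_tilde_def stencil_indices diff_weight_def scaleR_conv_of_real algebra_simps)

text \<open>
  Expressing the cubic term through the sum and the difference of \<open>p\<close> and \<open>q\<close> isolates all dependence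
  on the difference in one quadratic term, so that no cross terms need to be expanded.
\<close>

lemma cubic_term_parallelogram:
  fixes p q :: complex
  shows "of_real (lam / 4 * ((cmod p)\<^sup>2 + (cmod q)\<^sup>2)) * (p + q)
       = of_real lam * (of_real ((cmod ((p + q) / 2))\<^sup>2) * ((p + q) / 2)
           + of_real ((cmod (p - q))\<^sup>2 / 4) * ((p + q) / 2))"
proof -
  have "(cmod p)\<^sup>2 + (cmod q)\<^sup>2 = ((cmod (p + q))\<^sup>2 + (cmod (p - q))\<^sup>2) / 2"
    by (simp add: cmod_power2 power2_sum power2_diff)
  from arg_cong[OF this, of "\<lambda>r. lam / 4 * r"] have "lam / 4 * ((cmod p)\<^sup>2 + (cmod q)\<^sup>2)
      = lam / 2 * ((cmod ((p + q) / 2))\<^sup>2 + (cmod (p - q))\<^sup>2 / 4)"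
    by (simp add: norm_divide power_divide algebra_simps)
  moreover have "of_real (lam / 2 * (A + Q)) * s
      = of_real lam * (of_real A * (s / 2) + of_real Q * (s / 2))" for A Q and s :: complex
    by (simp add: algebra_simps)
  ultimately show ?thesis by (simp only:)
qed

lemma cubic_local_Lipschitz:
  fixes m w :: complex
  assumes "cmod m \<le> B" "cmod w \<le> B"
  shows "cmod (of_real ((cmod m)\<^sup>2) * m - of_real ((cmod w)\<^sup>2) * w) \<le> 3 * B\<^sup>2 * cmod (m - w)"
proof -
  have B: "0 \<le> B" using assms(1) norm_ge_zero order_trans by blast
  have sq: "\<bar>(cmod m)\<^sup>2 - (cmod w)\<^sup>2\<bar> \<le> 2 * B * cmod (m - w)"
  proof -
    have "\<bar>(cmod m)\<^sup>2 - (cmod w)\<^sup>2\<bar> = (cmod m + cmod w) * \<bar>cmod m - cmod w\<bar>"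
      by (simp add: power2_eq_square square_diff_square_factored abs_mult)
    also have "\<dots> \<le> (2 * B) * cmod (m - w)"
      using assms B by (intro mult_mono norm_triangle_ineq3) auto
    finally show ?thesis .
  qed
  have "cmod (of_real ((cmod m)\<^sup>2) * m - of_real ((cmod w)\<^sup>2) * w)
      = cmod (of_real ((cmod m)\<^sup>2) * (m - w) + of_real ((cmod m)\<^sup>2 - (cmod w)\<^sup>2) * w)"
    by (simp add: algebra_simps)
  also have "\<dots> \<le> (cmod m)\<^sup>2 * cmod (m - w) + \<bar>(cmod m)\<^sup>2 - (cmod w)\<^sup>2\<bar> * cmod w"
    by (rule norm_triangle_le) (simp add: norm_mult del: of_real_diff of_real_power)
  also have "\<dots> \<le> B\<^sup>2 * cmod (m - w) + (2 * B * cmod (m - w)) * B"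
    using assms sq B by (intro add_mono mult_mono power_mono) auto
  finally show ?thesis by (simp add: power2_eq_square algebra_simps)
qed

lemma trunc_error_uniform_bound:
  fixes D :: "'a::euclidean_space set" and u :: "'a \<times> real \<Rightarrow> complex"
  assumes D: "open D" "bounded D" and T: "T > 0" and sol: "smooth_NLS_solution lam D T u"
  obtains C where
    "\<And>\<tau> n x. \<tau> > 0 \<Longrightarrow> n \<ge> 3 \<Longrightarrow> real (n + 1) * \<tau> \<le> T \<Longrightarrow> x \<in> D \<Longrightarrow>
       cmod (trunc_error lam u \<tau> n x) \<le> C * \<tau>\<^sup>2"
proof -
  let ?U = "cylinder D T"
  let ?L = "space_laplacian_cl ?U u"
  have sm: "smooth_up_to_boundary ?U u" using sol by (simp add: smooth_NLS_solution_def)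
  have nil: "[] \<in> lists (Basis :: ('a \<times> real) set)" by simp
  have "bounded ?U" using D by (intro bounded_Times) auto
  with smooth_derivs_bounded[OF sm nil] obtain M where
    M: "\<And>p. p \<in> closure ?U \<Longrightarrow> cmod (u p) \<le> M" by auto
  obtain Cm where Cm: "Cm \<ge> 0"
    "\<And>x c \<tau>. x \<in> D \<Longrightarrow> \<tau> > 0 \<Longrightarrow> 2 * \<tau> \<le> c \<Longrightarrow> c + 2 * \<tau> \<le> T \<Longrightarrow>
       cmod (stencil mean_weight u x c \<tau> - u (x, c)) \<le> Cm * \<tau>\<^sup>2"
    using mean_stencil_error[OF sm T D(2) nil] unfolding partial_derivs_cl.simps(1) by blast
  obtain Cd where Cd: "Cd \<ge> 0"
    "\<And>x c \<tau>. x \<in> D \<Longrightarrow> \<tau> > 0 \<Longrightarrow> 2 * \<tau> \<le> c \<Longrightarrow> c + 2 * \<tau> \<le> T \<Longrightarrow>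
       cmod (stencil diff_weight u x c \<tau> - \<tau> *\<^sub>R time_deriv_cl ?U u (x, c)) \<le> Cd * \<tau> ^ 3"
    using diff_stencil_error[OF sm T D(2) nil]
    unfolding partial_derivs_cl.simps time_deriv_cl_def by blast
  obtain Cg where Cg: "Cg \<ge> 0"
    "\<And>x c \<tau>. x \<in> D \<Longrightarrow> \<tau> > 0 \<Longrightarrow> 2 * \<tau> \<le> c \<Longrightarrow> c + 2 * \<tau> \<le> T \<Longrightarrow>
       cmod (stencil diff_weight u x c \<tau>) \<le> Cg * \<tau>"
    using diff_stencil_bound[OF sm T D(2) nil] unfolding partial_derivs_cl.simps(1) by blast
  obtain CL where CL: "CL \<ge> 0"
    "\<And>x c \<tau>. x \<in> D \<Longrightarrow> \<tau> > 0 \<Longrightarrow> 2 * \<tau> \<le> c \<Longrightarrow> c + 2 * \<tau> \<le> T \<Longrightarrow>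
       cmod (stencil mean_weight ?L x c \<tau> - ?L (x, c)) \<le> CL * \<tau>\<^sup>2"
    using laplacian_stencil_error[OF sm T D(2)] by blast
  \<comment> \<open>A common bound for \<open>m\<close> and \<open>u(x, c)\<close>; it uses \<open>\<tau> \<le> T\<close>.\<close>
  define B where "B = \<bar>M\<bar> + Cm * T\<^sup>2"
  have "cmod (trunc_error lam u \<tau> n x)
      \<le> (Cd + CL + \<bar>lam\<bar> * (3 * B\<^sup>2 * Cm + Cg\<^sup>2 / 4 * B)) * \<tau>\<^sup>2"
    if \<tau>: "\<tau> > 0" and n: "n \<ge> 3" "real (n + 1) * \<tau> \<le> T" and x: "x \<in> D" for \<tau> n x
  proof -
    define c where "c = (real n - 1) * \<tau>"
    have "2 * \<tau> \<le> c" unfolding c_def using \<tau> n by (intro mult_right_mono) auto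
    moreover have "c + 2 * \<tau> \<le> T" using n unfolding c_def by (simp add: algebra_simps)
    ultimately have c: "2 * \<tau> \<le> c" "c + 2 * \<tau> \<le> T" .
    then have c0: "c \<in> {0..T}" and "\<tau> \<le> T" using \<tau> by auto
    define w where "w = u (x, c)"
    define m where "m = stencil mean_weight u x c \<tau>"
    define d where "d = stencil diff_weight u x c \<tau>"
    define l where "l = stencil mean_weight ?L x c \<tau>"
    define ut where "ut = time_deriv_cl ?U u (x, c)"
    have sum: "R_tilde u \<tau> (n + 1) x + R_tilde u \<tau> n x = 2 * m"
      and diff: "R_tilde u \<tau> (n + 1) x - R_tilde u \<tau> n x = d"
      unfolding m_def d_def c_def by (rule R_tilde_sum_eq_stencil R_tilde_diff_eq_stencil)+
    have "(\<lambda>y. R_tilde u \<tau> (n + 1) y + R_tilde u \<tau> n y)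
        = (\<lambda>y. \<Sum>k\<in>{-2..2}. (2 * mean_weight k) *\<^sub>R u (y, c + of_int k * \<tau>))"
      unfolding R_tilde_sum_eq_stencil c_def
      by (simp add: sum_distrib_left scaleR_conv_of_real mult.assoc)
    then have "laplacian (\<lambda>y. R_tilde u \<tau> (n + 1) y + R_tilde u \<tau> n y) x
        = laplacian (\<lambda>y. \<Sum>k\<in>{-2..2}. (2 * mean_weight k) *\<^sub>R u (y, c + of_int k * \<tau>)) x"
      by (rule arg_cong)
    also have "\<dots> = (\<Sum>k\<in>{-2..2}. (2 * mean_weight k) *\<^sub>R ?L (x, c + of_int k * \<tau>))"
      by (rule laplacian_sum_slices[OF sm T D(1) x stencil_nodes[OF \<tau> c]])
    also have "\<dots> = 2 * l"
      unfolding l_def by (simp add: sum_distrib_left scaleR_conv_of_real mult.assoc)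
    finally have lap: "laplacian (\<lambda>y. R_tilde u \<tau> (n + 1) y + R_tilde u \<tau> n y) x = 2 * l" .
    have "x \<in> closure D" using x closure_subset by blast
    with sol c0 have pde: "\<i> * ut + ?L (x, c) - of_real (lam * (cmod w)\<^sup>2) * w = 0"
      unfolding smooth_NLS_solution_def ut_def w_def by blast
    have w: "cmod w \<le> \<bar>M\<bar>"
      using M[of "(x, c)"] \<open>x \<in> closure D\<close> c0 by (simp add: w_def closure_cylinder[OF T])
    have mw: "cmod (m - w) \<le> Cm * \<tau>\<^sup>2" unfolding m_def w_def by (rule Cm(2)[OF x \<tau> c])
    also have "\<dots> \<le> Cm * T\<^sup>2"
      using Cm(1) \<tau> \<open>\<tau> \<le> T\<close> by (intro mult_left_mono power_mono) auto
    finally have "cmod (m - w) \<le> Cm * T\<^sup>2" .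
    moreover have "0 \<le> Cm * T\<^sup>2" using Cm(1) by simp
    ultimately have "cmod m \<le> B" "cmod w \<le> B" "B \<ge> 0"
      using w norm_triangle_sub[of m w] unfolding B_def by linarith+
    define e where "e = of_real ((cmod m)\<^sup>2) * m - of_real ((cmod w)\<^sup>2) * w"
    have "cmod e \<le> 3 * B\<^sup>2 * cmod (m - w)"
      unfolding e_def by (rule cubic_local_Lipschitz) fact+
    also have "\<dots> \<le> 3 * B\<^sup>2 * (Cm * \<tau>\<^sup>2)" using mw by (intro mult_left_mono) auto
    finally have e: "cmod e \<le> 3 * B\<^sup>2 * Cm * \<tau>\<^sup>2" by (simp add: mult_ac)
    have "(cmod d)\<^sup>2 \<le> (Cg * \<tau>)\<^sup>2"
      unfolding d_def using Cg(2)[OF x \<tau> c] by (intro power_mono) auto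
    then have "cmod (of_real ((cmod d)\<^sup>2 / 4) * m) \<le> (Cg * \<tau>)\<^sup>2 / 4 * B"
      using \<open>cmod m \<le> B\<close> by (auto simp: norm_mult norm_power norm_divide intro!: mult_mono)
    then have dm: "cmod (of_real ((cmod d)\<^sup>2 / 4) * m) \<le> Cg\<^sup>2 / 4 * B * \<tau>\<^sup>2"
      by (simp add: power_mult_distrib mult_ac)
    have "cmod ((\<i> / of_real \<tau>) * (d - \<tau> *\<^sub>R ut)) \<le> Cd * \<tau> ^ 3 / \<tau>"
      using Cd(2)[OF x \<tau> c] \<tau>
      by (simp add: norm_mult norm_divide d_def ut_def divide_right_mono)
    then have dt: "cmod ((\<i> / of_real \<tau>) * (d - \<tau> *\<^sub>R ut)) \<le> Cd * \<tau>\<^sup>2"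
      using \<tau> by (simp add: power3_eq_cube power2_eq_square)
    have lt: "cmod (l - ?L (x, c)) \<le> CL * \<tau>\<^sup>2"
      unfolding l_def by (rule CL(2)[OF x \<tau> c])
    have "cmod (e + of_real ((cmod d)\<^sup>2 / 4) * m)
        \<le> 3 * B\<^sup>2 * Cm * \<tau>\<^sup>2 + Cg\<^sup>2 / 4 * B * \<tau>\<^sup>2"
      using e dm by (rule norm_triangle_mono)
    then have nt: "cmod (of_real lam * (e + of_real ((cmod d)\<^sup>2 / 4) * m))
        \<le> \<bar>lam\<bar> * (3 * B\<^sup>2 * Cm * \<tau>\<^sup>2 + Cg\<^sup>2 / 4 * B * \<tau>\<^sup>2)"
      unfolding norm_mult norm_of_real by (rule mult_left_mono) simp
    \<comment> \<open>Insert the equation at \<open>(x, c)\<close>, so that each term is compared with its value there.\<close>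
    have "trunc_error lam u \<tau> n x = (\<i> / of_real \<tau>) * d + l
        - of_real lam * (of_real ((cmod m)\<^sup>2) * m + of_real ((cmod d)\<^sup>2 / 4) * m)"
      unfolding trunc_error_def cubic_term_parallelogram unfolding sum diff lap by simp
    also have "\<dots> = (\<i> / of_real \<tau>) * (d - \<tau> *\<^sub>R ut) + (l - ?L (x, c))
        - of_real lam * (e + of_real ((cmod d)\<^sup>2 / 4) * m)
        + (\<i> * ut + ?L (x, c) - of_real (lam * (cmod w)\<^sup>2) * w)"
      using \<tau> by (simp add: e_def scaleR_conv_of_real right_diff_distrib distrib_left)
    also have "\<dots> = (\<i> / of_real \<tau>) * (d - \<tau> *\<^sub>R ut) + (l - ?L (x, c))
        - of_real lam * (e + of_real ((cmod d)\<^sup>2 / 4) * m)"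
      unfolding pde by simp
    also have "cmod \<dots> \<le> Cd * \<tau>\<^sup>2 + CL * \<tau>\<^sup>2
        + \<bar>lam\<bar> * (3 * B\<^sup>2 * Cm * \<tau>\<^sup>2 + Cg\<^sup>2 / 4 * B * \<tau>\<^sup>2)"
      by (rule order_trans[OF norm_triangle_ineq4 add_mono[OF norm_triangle_mono[OF dt lt] nt]])
    finally show ?thesis by (simp add: algebra_simps)
  qed
  then show ?thesis by (rule that)
qed

theorem lemma3p4:
  fixes D :: "(real ^ 'd) set" and T lam :: real and u :: "(real ^ 'd) \<times> real \<Rightarrow> complex"
  assumes dim: "CARD('d) \<in> {1, 2, 3}"
    and domain_D: "open D" "connected D" "D \<noteq> {}" "bounded D"
    and T_pos: "T > 0"
    and lam: "lam \<in> {1, -1}"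
    and sol: "smooth_NLS_solution lam D T u"
  shows "\<exists>C::real. \<forall>\<tau>>0. \<forall>n\<ge>3. real (n + 1) * \<tau> \<le> T \<longrightarrow>
           bdd_above ((\<lambda>x. cmod (trunc_error lam u \<tau> n x)) ` D) \<and>
           (SUP x\<in>D. cmod (trunc_error lam u \<tau> n x)) \<le> C * \<tau>\<^sup>2"
proof -
  obtain C where C: "\<And>\<tau> n x. \<tau> > 0 \<Longrightarrow> n \<ge> 3 \<Longrightarrow> real (n + 1) * \<tau> \<le> T \<Longrightarrow> x \<in> D \<Longrightarrow>
       cmod (trunc_error lam u \<tau> n x) \<le> C * \<tau>\<^sup>2"
    using trunc_error_uniform_bound[OF domain_D(1,4) T_pos sol] by blast
  show ?thesis
  proof (intro exI[of _ C] allI impI conjI)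
    fix \<tau> :: real and n :: nat
    assume *: "\<tau> > 0" "n \<ge> 3" "real (n + 1) * \<tau> \<le> T"
    show "bdd_above ((\<lambda>x. cmod (trunc_error lam u \<tau> n x)) ` D)"
      using C[OF *] by (rule bdd_aboveI2)
    show "(SUP x\<in>D. cmod (trunc_error lam u \<tau> n x)) \<le> C * \<tau>\<^sup>2"
      using domain_D(3) C[OF *] by (rule cSUP_least)
  qed
qed

end
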